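(* Let $(M,g)$ be a compact Riemannian manifold without boundary, let $E\subset M$ be measurable, let $S$ be a finite subset of the spectrum $\{\lambda_j\}$ of $\sqrt{-\Delta_g}$, and let $X_S=\{j:\lambda_j\in S\}$. Let $f\in L^2(M)$ be nonzero, and suppose that for some $0\le \epsilon<1$ and $0\le\epsilon'<1$, $f$ is $L^2$-concentrated on $E$ at level $(1-\epsilon^2)^{-1/2}$ and $\widehat f$ is $L^2$-concentrated on $X_S$ at level $(1-\epsilon'^2)^{-1/2}$, i.e. $$\int_E |f(x)|^2\,dx\ \ge\ (1-\epsilon)\|f\|_{L^2(M)}^2,\qquad \sum_{j\in X_S}|\widehat f(j)|^2\ \ge\ (1-\epsilon')\|f\|_{L^2(M)}^2 .$$ If $\epsilon,\epsilon'$ are small enough that $0<1-\epsilon-\epsilon'\le 1$, then $$(1-\epsilon-\epsilon')^2\ \le\ \frac{|E|}{|M|}\cdot \# X_S\cdot \sup_{x\in E}\frac{A_S(x)}{\frac{\# X_S}{|M|}},\qquad\text{where } A_S(x)=\sum_{j\in X_S}|e_j(x)|^2 .$$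
   Context: $\Delta_g$ is the Laplace-Beltrami operator of $(M,g)$. $\{e_j\}$ is an $L^2(M)$-orthonormal basis of eigenfunctions, $-\Delta_g e_j=\lambda_j^2 e_j$, with $0=\lambda_0\le\lambda_1\le\cdots$ (eigenvalues repeated according to multiplicity). $\widehat f(j)=\langle f,e_j\rangle_{L^2(M)}$. $dx$ is the Riemannian volume measure, $|E|$ and $|M|$ denote Riemannian volumes, and $\#X_S$ is the cardinality of $X_S$. *)

theory Defs
  imports "HOL-Analysis.Analysis"
begin

section \<open>Smooth functions on open subsets of Euclidean space\<close>

definition partial_deriv ::
    "'n \<Rightarrow> (real ^ 'n \<Rightarrow> 'b::real_normed_vector) \<Rightarrow> real ^ 'n \<Rightarrow> 'b" where
  "partial_deriv i f y = frechet_derivative f (at y) (axis i 1)"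

text \<open>Only used for open \<open>V\<close>, where values of \<open>f\<close> outside \<open>V\<close> are irrelevant.\<close>

primrec Ck_on :: "nat \<Rightarrow> (real ^ 'n) set \<Rightarrow> (real ^ 'n \<Rightarrow> 'b::real_normed_vector) \<Rightarrow> bool" where
  "Ck_on 0 V f \<longleftrightarrow> continuous_on V f"
| "Ck_on (Suc k) V f \<longleftrightarrow>
     f differentiable_on V \<and> (\<forall>i. Ck_on k V (partial_deriv i f))"

definition smooth_on :: "(real ^ 'n) set \<Rightarrow> (real ^ 'n \<Rightarrow> 'b::real_normed_vector) \<Rightarrow> bool" where
  "smooth_on V f \<longleftrightarrow> (\<forall>k. Ck_on k V f)"


section \<open>Smooth manifolds without boundary\<close>

text \<open>
  The underlying space of the manifold is a whole (Hausdorff) type \<open>'a\<close>. A chart consists of its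
  domain and its coordinate map; since its image is required to be open in \<open>real ^ 'n\<close>,
  manifolds are without boundary. The dimension \<open>CARD('n)\<close> is an arbitrary positive number.
  Second countability is automatic for compact manifolds and therefore not imposed.
\<close>

type_synonym ('a, 'n) chart = "'a set \<times> ('a \<Rightarrow> real ^ 'n)"

definition chart_inv :: "('a, 'n) chart \<Rightarrow> real ^ 'n \<Rightarrow> 'a" where
  "chart_inv c = inv_into (fst c) (snd c)"

definition chart_image :: "('a, 'n) chart \<Rightarrow> (real ^ 'n) set" where
  "chart_image c = snd c ` fst c"

definition is_chart :: "('a::topological_space, 'n::finite) chart \<Rightarrow> bool" where
  "is_chart c \<longleftrightarrow> open (fst c) \<and> open (chart_image c) \<and>
     homeomorphism (fst c) (chart_image c) (snd c) (chart_inv c)"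

definition transition :: "('a, 'n) chart \<Rightarrow> ('a, 'n) chart \<Rightarrow> real ^ 'n \<Rightarrow> real ^ 'n" where
  "transition c d = snd d \<circ> chart_inv c"

definition smooth_atlas :: "('a::topological_space, 'n::finite) chart set \<Rightarrow> bool" where
  "smooth_atlas \<A> \<longleftrightarrow>
     (\<forall>c\<in>\<A>. is_chart c) \<and>
     (\<Union>c\<in>\<A>. fst c) = UNIV \<and>
     (\<forall>c\<in>\<A>. \<forall>d\<in>\<A>. smooth_on (snd c ` (fst c \<inter> fst d)) (transition c d))"

definition smooth_function ::
    "('a::topological_space, 'n::finite) chart set \<Rightarrow> ('a \<Rightarrow> 'b::real_normed_vector) \<Rightarrow> bool" where
  "smooth_function \<A> u \<longleftrightarrow> (\<forall>c\<in>\<A>. smooth_on (chart_image c) (u \<circ> chart_inv c))"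


section \<open>Riemannian metrics\<close>

text \<open>
  A metric is given by its component matrices: \<open>g c p\<close> is the matrix \<open>(g\<^sub>i\<^sub>j)\<close> at the point \<open>p\<close>
  with respect to the coordinates of the chart \<open>c\<close>. The last condition is the transformation law
  of a covariant 2-tensor.
\<close>

type_synonym ('a, 'n) metric = "('a, 'n) chart \<Rightarrow> 'a \<Rightarrow> real ^ 'n ^ 'n"

definition riemannian_metric ::
    "('a::topological_space, 'n::finite) chart set \<Rightarrow> ('a, 'n) metric \<Rightarrow> bool" where
  "riemannian_metric \<A> g \<longleftrightarrow>
     (\<forall>c\<in>\<A>. smooth_on (chart_image c) (g c \<circ> chart_inv c)) \<and>
     (\<forall>c\<in>\<A>. \<forall>p\<in>fst c. transpose (g c p) = g c p \<and> (\<forall>v. v \<noteq> 0 \<longrightarrow> v \<bullet> (g c p *v v) > 0)) \<and>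
     (\<forall>c\<in>\<A>. \<forall>d\<in>\<A>. \<forall>p\<in>fst c \<inter> fst d.
        let J = matrix (frechet_derivative (transition c d) (at (snd c p)))
        in g c p = transpose J ** g d p ** J)"

definition compact_riemannian_manifold ::
    "('a::t2_space, 'n::finite) chart set \<Rightarrow> ('a, 'n) metric \<Rightarrow> bool" where
  "compact_riemannian_manifold \<A> g \<longleftrightarrow>
     compact (UNIV :: 'a set) \<and> smooth_atlas \<A> \<and> riemannian_metric \<A> g"

definition volume_density :: "('a, 'n::finite) metric \<Rightarrow> ('a, 'n) chart \<Rightarrow> real ^ 'n \<Rightarrow> real" where
  "volume_density g c y = sqrt (det (g c (chart_inv c y)))"

text \<open>
  The Riemannian volume measure is the unique Borel measure that in every chart is
  \<open>sqrt (det g)\<close> times Lebesgue measure; as for \<^const>\<open>lebesgue\<close>, it is completed, so that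
  measurable sets and functions are understood in the Lebesgue sense.
\<close>

definition riemannian_volume ::
    "('a::topological_space, 'n::finite) chart set \<Rightarrow> ('a, 'n) metric \<Rightarrow> 'a measure \<Rightarrow> bool" where
  "riemannian_volume \<A> g vol \<longleftrightarrow>
     (\<exists>\<mu>. vol = completion \<mu> \<and> sets \<mu> = sets borel \<and>
        (\<forall>c\<in>\<A>. \<forall>B\<in>sets borel. B \<subseteq> fst c \<longrightarrow>
           emeasure \<mu> B = (\<integral>\<^sup>+ y \<in> snd c ` B. ennreal (volume_density g c y) \<partial>lborel)))"


section \<open>The Laplace-Beltrami operator\<close>

text \<open>The expression \<open>|g|\<^sup>-\<^sup>1\<^sup>/\<^sup>2 \<Sum>\<^sub>i \<partial>\<^sub>i (|g|\<^sup>1\<^sup>/\<^sup>2 \<Sum>\<^sub>j g\<^sup>i\<^sup>j \<partial>\<^sub>j u)\<close> in the coordinates of the chart \<open>c\<close>.\<close>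

definition laplace_in_chart ::
    "('a, 'n::finite) metric \<Rightarrow> ('a, 'n) chart \<Rightarrow> ('a \<Rightarrow> complex) \<Rightarrow> 'a \<Rightarrow> complex" where
  "laplace_in_chart g c u p =
     (\<Sum>i\<in>UNIV. partial_deriv i
        (\<lambda>y. volume_density g c y *\<^sub>R
           (\<Sum>j\<in>UNIV. (matrix_inv (g c (chart_inv c y)) $ i $ j) *\<^sub>R
               partial_deriv j (u \<circ> chart_inv c) y))
        (snd c p)) /\<^sub>R volume_density g c (snd c p)"

text \<open>For smooth \<open>u\<close> the value does not depend on the chart chosen around \<open>p\<close>.\<close>

definition laplace_beltrami ::
    "('a, 'n::finite) chart set \<Rightarrow> ('a, 'n) metric \<Rightarrow> ('a \<Rightarrow> complex) \<Rightarrow> 'a \<Rightarrow> complex" where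
  "laplace_beltrami \<A> g u p = laplace_in_chart g (SOME c. c \<in> \<A> \<and> p \<in> fst c) u p"


section \<open>Square-integrable functions and orthonormal bases of eigenfunctions\<close>

definition square_integrable :: "'a measure \<Rightarrow> ('a \<Rightarrow> complex) \<Rightarrow> bool" where
  "square_integrable M f \<longleftrightarrow>
     f \<in> borel_measurable M \<and> integrable M (\<lambda>x. (cmod (f x))\<^sup>2)"

definition L2_inner :: "'a measure \<Rightarrow> ('a \<Rightarrow> complex) \<Rightarrow> ('a \<Rightarrow> complex) \<Rightarrow> complex" where
  "L2_inner M f h = (\<integral>x. f x * cnj (h x) \<partial>M)"

definition L2_norm :: "'a measure \<Rightarrow> ('a \<Rightarrow> complex) \<Rightarrow> real" where
  "L2_norm M f = sqrt (\<integral>x. (cmod (f x))\<^sup>2 \<partial>M)"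

definition L2_orthonormal_basis :: "'a measure \<Rightarrow> (nat \<Rightarrow> 'a \<Rightarrow> complex) \<Rightarrow> bool" where
  "L2_orthonormal_basis M e \<longleftrightarrow>
     (\<forall>j. square_integrable M (e j)) \<and>
     (\<forall>i j. L2_inner M (e i) (e j) = (if i = j then 1 else 0)) \<and>
     (\<forall>f. square_integrable M f \<longrightarrow>
        (\<lambda>n. L2_norm M (\<lambda>x. f x - (\<Sum>j<n. L2_inner M f (e j) * e j x))) \<longlonglongrightarrow> 0)"

text \<open>
  Eigenfunctions are taken to be smooth functions rather than classes modulo null sets, so that
  their values at points make sense (by elliptic regularity this is no restriction).
\<close>

definition laplace_eigenbasis ::
    "('a::topological_space, 'n::finite) chart set \<Rightarrow> ('a, 'n) metric \<Rightarrow> 'a measure \<Rightarrow>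
     (nat \<Rightarrow> 'a \<Rightarrow> complex) \<Rightarrow> (nat \<Rightarrow> real) \<Rightarrow> bool" where
  "laplace_eigenbasis \<A> g vol e lam \<longleftrightarrow>
     L2_orthonormal_basis vol e \<and>
     lam 0 = 0 \<and> incseq lam \<and>
     (\<forall>j. smooth_function \<A> (e j) \<and>
          (\<forall>p. - laplace_beltrami \<A> g (e j) p = of_real ((lam j)\<^sup>2) * e j p))"

text \<open>
  For finite \<open>S\<close> the index set \<open>X\<^sub>S\<close> is finite, since eigenvalues of the Laplace-Beltrami operator on a
  compact manifold have finite multiplicity.
\<close>

definition spectral_indices :: "(nat \<Rightarrow> real) \<Rightarrow> real set \<Rightarrow> nat set" where
  "spectral_indices lam S = {j. lam j \<in> S}"

definition spectral_function ::
    "(nat \<Rightarrow> 'a \<Rightarrow> complex) \<Rightarrow> (nat \<Rightarrow> real) \<Rightarrow> real set \<Rightarrow> 'a \<Rightarrow> real" where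
  "spectral_function e lam S x = (\<Sum>j\<in>spectral_indices lam S. (cmod (e j x))\<^sup>2)"

end

theory Submission
  imports Defs
begin

text \<open>
  Let \<open>P\<close> be the orthogonal projection of \<open>L\<^sup>2\<close> onto the span of the \<open>e\<^sub>j\<close> with \<open>j \<in> X\<^sub>S\<close>, and \<open>Q\<close>
  multiplication by the indicator function of \<open>E\<close>. The two concentration hypotheses add up to
  \<open>(2 - \<epsilon> - \<epsilon>') \<parallel>f\<parallel>\<^sup>2 \<le> \<parallel>Pf\<parallel>\<^sup>2 + \<parallel>Qf\<parallel>\<^sup>2\<close>. Two projections satisfy \<open>P + Q \<le> 1 + \<parallel>QP\<parallel>\<close>, so
  \<open>1 - \<epsilon> - \<epsilon>' \<le> \<parallel>QP\<parallel>\<close>. By the Cauchy-Schwarz inequality on the finite sum defining \<open>Pf\<close>,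
  \<open>|Pf x|\<^sup>2 \<le> \<parallel>Pf\<parallel>\<^sup>2 A\<^sub>S(x)\<close> at every point, and integrating over \<open>E\<close> gives
  \<open>\<parallel>QPf\<parallel>\<^sup>2 \<le> |E| (sup\<^sub>E A\<^sub>S) \<parallel>Pf\<parallel>\<^sup>2\<close>. Hence \<open>(1 - \<epsilon> - \<epsilon>')\<^sup>2 \<le> |E| sup\<^sub>E A\<^sub>S\<close>, which is the claim: the
  factors \<open>|M|\<close> and \<open>#X\<^sub>S\<close> cancel. This argument is \<open>concentration_sum_bound\<close>, valid for a set \<open>E\<close>
  of finite measure in any measure space, with \<open>projections_sum_bound\<close> as its Hilbert space core.

  The geometry enters through compactness. It makes \<open>|M|\<close> finite, so that dividing by it is
  meaningful (\<open>riemannian_volume_finite\<close>), and it makes the continuous function \<open>A\<^sub>S\<close> bounded, so that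
  the supremum is a genuine upper bound.
\<close>

section \<open>Finiteness of the volume and boundedness of smooth functions\<close>

lemma smooth_on_imp_continuous_on: "smooth_on V f \<Longrightarrow> continuous_on V f"
  unfolding smooth_on_def by (metis Ck_on.simps(1))

text \<open>
  Smoothness speaks of \<open>u\<close> read in coordinates; composing with the homeomorphic coordinate maps turns
  it into continuity on the chart domains, which form an open cover.
\<close>

lemma smooth_function_imp_continuous:
  fixes \<A> :: "('a::topological_space, 'n::finite) chart set" and u :: "'a \<Rightarrow> 'b::real_normed_vector"
  assumes "smooth_atlas \<A>" "smooth_function \<A> u"
  shows "continuous_on UNIV u"
proof -
  have "continuous_on (fst c) u" if "c \<in> \<A>" for c
  proof -
    have hom: "homeomorphism (fst c) (chart_image c) (snd c) (chart_inv c)"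
      using assms(1) that by (auto simp: smooth_atlas_def is_chart_def)
    have "continuous_on (chart_image c) (u \<circ> chart_inv c)"
      using assms(2) that unfolding smooth_function_def by (blast intro: smooth_on_imp_continuous_on)
    then have "continuous_on (fst c) ((u \<circ> chart_inv c) \<circ> snd c)"
      using hom unfolding homeomorphism_def by (metis continuous_on_compose)
    moreover have "((u \<circ> chart_inv c) \<circ> snd c) p = u p" if "p \<in> fst c" for p
      using hom that by (simp add: homeomorphism_def)
    ultimately show ?thesis
      by (simp cong: continuous_on_cong)
  qed
  moreover have "open (fst c)" if "c \<in> \<A>" for c
    using assms(1) that by (auto simp: smooth_atlas_def is_chart_def)
  moreover have "(\<Union>c\<in>\<A>. fst c) = UNIV"
    using assms(1) by (simp add: smooth_atlas_def)
  ultimately show ?thesis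
    using continuous_on_open_UN[of \<A> fst u] by metis
qed

lemma continuous_on_volume_density:
  assumes "riemannian_metric \<A> g" "c \<in> \<A>"
  shows "continuous_on (chart_image c) (volume_density g c)"
proof -
  have "continuous_on (chart_image c) (g c \<circ> chart_inv c)"
    using assms unfolding riemannian_metric_def by (blast intro: smooth_on_imp_continuous_on)
  then have "continuous_on (chart_image c) (\<lambda>y. g c (chart_inv c y))"
    by (simp add: o_def)
  then show ?thesis
    unfolding volume_density_def[abs_def] det_def by (intro continuous_intros)
qed

text \<open>A small coordinate ball has compact closure in its chart, on which the density is bounded; finitely
  many such balls cover a compact manifold.\<close>

lemma riemannian_volume_finite:
  fixes \<A> :: "('a::t2_space, 'n::finite) chart set"
  assumes M: "compact_riemannian_manifold \<A> g" and vol: "riemannian_volume \<A> g vol"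
  shows "space vol = UNIV" "finite_measure vol"
proof -
  obtain \<mu> where \<mu>: "vol = completion \<mu>" "sets \<mu> = sets borel"
    and vol_chart: "\<And>c B. c \<in> \<A> \<Longrightarrow> B \<in> sets borel \<Longrightarrow> B \<subseteq> fst c \<Longrightarrow>
      emeasure \<mu> B = (\<integral>\<^sup>+ y \<in> snd c ` B. ennreal (volume_density g c y) \<partial>lborel)"
    using vol unfolding riemannian_volume_def by metis
  have space: "space \<mu> = UNIV"
    using sets_eq_imp_space_eq[OF \<mu>(2)] by simp
  then show "space vol = UNIV" by (simp add: \<mu>(1))
  have "\<exists>U. open U \<and> p \<in> U \<and> emeasure \<mu> U < \<infinity>" for p
  proof -
    obtain c where c: "c \<in> \<A>" "p \<in> fst c" "open (fst c)" "open (chart_image c)"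
        "homeomorphism (fst c) (chart_image c) (snd c) (chart_inv c)"
      using M unfolding compact_riemannian_manifold_def smooth_atlas_def is_chart_def by blast
    have "snd c p \<in> chart_image c" using c(2) by (simp add: chart_image_def)
    then obtain r where r: "r > 0" "cball (snd c p) r \<subseteq> chart_image c"
      using c(4) open_contains_cball by blast
    have "continuous_on (cball (snd c p) r) (volume_density g c)"
      using M c(1) r(2) continuous_on_volume_density continuous_on_subset
      by (metis compact_riemannian_manifold_def)
    then have "bounded (volume_density g c ` cball (snd c p) r)"
      using compact_continuous_image compact_imp_bounded compact_cball by blast
    then obtain D where "\<forall>y\<in>cball (snd c p) r. \<bar>volume_density g c y\<bar> \<le> D"
      unfolding bounded_real by blast
    then have D: "volume_density g c y \<le> D" if "y \<in> cball (snd c p) r" for y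
      using that abs_le_D1 by blast
    define U where "U = fst c \<inter> snd c -` ball (snd c p) r"
    have "open U"
      unfolding U_def using c by (intro continuous_open_preimage) (auto simp: homeomorphism_def)
    have image: "snd c ` U = ball (snd c p) r"
    proof
      show "ball (snd c p) r \<subseteq> snd c ` U"
      proof
        fix y assume y: "y \<in> ball (snd c p) r"
        then have "y \<in> snd c ` fst c"
          using r(2) by (auto simp: chart_image_def)
        then show "y \<in> snd c ` U" using y by (auto simp: U_def)
      qed
    qed (auto simp: U_def)
    have "emeasure \<mu> U = (\<integral>\<^sup>+ y \<in> ball (snd c p) r. ennreal (volume_density g c y) \<partial>lborel)"
      using vol_chart[OF c(1), of U] \<open>open U\<close> image by (auto simp: U_def)
    also have "\<dots> \<le> (\<integral>\<^sup>+ y \<in> ball (snd c p) r. ennreal D \<partial>lborel)"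
      using D by (intro nn_integral_mono) (auto simp: indicator_def intro!: ennreal_leI)
    also have "\<dots> = ennreal D * emeasure lborel (ball (snd c p) r)"
      by (simp add: nn_integral_cmult_indicator)
    also have "\<dots> < \<infinity>"
      by (simp add: ennreal_mult_less_top emeasure_lborel_ball_finite[unfolded infinity_ennreal_def])
    finally show ?thesis
      using \<open>open U\<close> c(2) r(1) by (auto simp: U_def)
  qed
  then obtain U where U: "\<And>p. open (U p)" "\<And>p. p \<in> U p" "\<And>p. emeasure \<mu> (U p) < \<infinity>"
    by metis
  have "compact (UNIV :: 'a set)" using M by (simp add: compact_riemannian_manifold_def)
  then obtain P where P: "finite P" "UNIV \<subseteq> (\<Union>p\<in>P. U p)"
    using U(1,2) by (elim compactE_image[of _ UNIV U]) auto
  have "emeasure \<mu> (\<Union>p\<in>P. U p) \<le> (\<Sum>p\<in>P. emeasure \<mu> (U p))"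
    using U(1) \<mu>(2) P(1) by (intro emeasure_subadditive_finite) auto
  also have "\<dots> < \<infinity>" using U(3) P(1) by auto
  finally have "emeasure \<mu> UNIV < \<infinity>" using P(2) by (simp add: top.extremum_unique)
  then show "finite_measure vol"
    using space by (intro finite_measureI) (auto simp: \<mu>)
qed

section \<open>Square-integrable functions\<close>

lemma square_integrable_mult_cnj_integrable:
  assumes "square_integrable M u" "square_integrable M v"
  shows "integrable M (\<lambda>x. u x * cnj (v x))"
proof (rule Bochner_Integration.integrable_bound)
  show "integrable M (\<lambda>x. (cmod (u x))\<^sup>2 + (cmod (v x))\<^sup>2)"
    using assms by (auto simp: square_integrable_def)
  show "(\<lambda>x. u x * cnj (v x)) \<in> borel_measurable M"
    using assms unfolding square_integrable_def
    by (intro borel_measurable_times borel_measurable_continuous_on[where f = cnj])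
      (auto intro: continuous_intros)
  have "cmod (u x * cnj (v x)) \<le> (cmod (u x))\<^sup>2 + (cmod (v x))\<^sup>2" for x
  proof -
    have "2 * (cmod (u x) * cmod (v x)) \<le> (cmod (u x))\<^sup>2 + (cmod (v x))\<^sup>2"
      using sum_squares_bound[of "cmod (u x)" "cmod (v x)"] by (simp add: mult.assoc)
    moreover have "0 \<le> cmod (u x) * cmod (v x)" by simp
    ultimately show ?thesis unfolding norm_mult complex_mod_cnj by linarith
  qed
  then show "AE x in M. cmod (u x * cnj (v x)) \<le> norm ((cmod (u x))\<^sup>2 + (cmod (v x))\<^sup>2)"
    by simp
qed

lemma square_integrable_scale:
  assumes "square_integrable M u"
  shows "square_integrable M (\<lambda>x. a * u x)"
  using assms by (auto simp: square_integrable_def norm_mult power_mult_distrib)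

lemma square_integrable_add:
  assumes "square_integrable M u" "square_integrable M v"
  shows "square_integrable M (\<lambda>x. u x + v x)"
  unfolding square_integrable_def
proof
  show meas: "(\<lambda>x. u x + v x) \<in> borel_measurable M"
    using assms unfolding square_integrable_def by (intro borel_measurable_add) auto
  show "integrable M (\<lambda>x. (cmod (u x + v x))\<^sup>2)"
  proof (rule Bochner_Integration.integrable_bound)
    show "integrable M (\<lambda>x. 2 * (cmod (u x))\<^sup>2 + 2 * (cmod (v x))\<^sup>2)"
      using assms by (auto simp: square_integrable_def)
    show "(\<lambda>x. (cmod (u x + v x))\<^sup>2) \<in> borel_measurable M" using meas by measurable
    have "(cmod (u x + v x))\<^sup>2 \<le> 2 * (cmod (u x))\<^sup>2 + 2 * (cmod (v x))\<^sup>2" for x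
      using power_mono[OF norm_triangle_ineq[of "u x" "v x"], of 2]
        sum_squares_bound[of "cmod (u x)" "cmod (v x)"]
      by (simp add: power2_sum)
    then show "AE x in M. norm ((cmod (u x + v x))\<^sup>2) \<le> norm (2 * (cmod (u x))\<^sup>2 + 2 * (cmod (v x))\<^sup>2)"
      by simp
  qed
qed

lemma square_integrable_sum:
  assumes "finite X" "\<And>j. j \<in> X \<Longrightarrow> square_integrable M (u j)"
  shows "square_integrable M (\<lambda>x. \<Sum>j\<in>X. u j x)"
  using assms
proof (induction X rule: finite_induct)
  case empty
  then show ?case by (simp add: square_integrable_def)
next
  case (insert j X)
  then show ?case by (simp add: square_integrable_add)
qed

lemma square_integrable_restrict:
  assumes "square_integrable M f" "E \<in> sets M"
  shows "square_integrable M (\<lambda>x. indicator E x *\<^sub>R f x)"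
proof -
  have "integrable M (\<lambda>x. indicator E x *\<^sub>R (cmod (f x))\<^sup>2)"
    using assms by (intro integrable_mult_indicator) (auto simp: square_integrable_def)
  moreover have "(cmod (indicator E x *\<^sub>R f x))\<^sup>2 = indicator E x *\<^sub>R (cmod (f x))\<^sup>2" for x
    by (simp add: indicator_def)
  ultimately show ?thesis
    using assms by (auto simp: square_integrable_def)
qed

lemma square_integrable_inner_integrable:
  assumes "square_integrable M u" "square_integrable M v"
  shows "integrable M (\<lambda>x. u x \<bullet> v x)"
  using integrable_Re[OF square_integrable_mult_cnj_integrable[OF assms]]
  by (simp add: inner_complex_def)

text \<open>
  Orthogonality relations are computed with the complex inner product, norm estimates with its real
  part, where expanding a square is real bilinear algebra; this identity links the two.
\<close>

lemma Re_L2_inner: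
  assumes "square_integrable M u" "square_integrable M v"
  shows "Re (L2_inner M u v) = (\<integral>x. u x \<bullet> v x \<partial>M)"
  unfolding L2_inner_def integral_Re[OF square_integrable_mult_cnj_integrable[OF assms], symmetric]
  by (simp add: inner_complex_def)

lemma L2_inner_commute: "L2_inner M v u = cnj (L2_inner M u v)"
proof -
  have "cnj (L2_inner M u v) = (\<integral>x. cnj (u x * cnj (v x)) \<partial>M)"
    unfolding L2_inner_def by (simp only: Bochner_Integration.integral_cnj)
  then show ?thesis by (simp add: L2_inner_def mult.commute)
qed

lemma L2_inner_sum_left:
  assumes "\<And>j. j \<in> X \<Longrightarrow> square_integrable M (u j)" "square_integrable M v"
  shows "L2_inner M (\<lambda>x. \<Sum>j\<in>X. a j * u j x) v = (\<Sum>j\<in>X. a j * L2_inner M (u j) v)"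
proof -
  have "(\<integral>x. (\<Sum>j\<in>X. a j * u j x) * cnj (v x) \<partial>M) = (\<integral>x. (\<Sum>j\<in>X. a j * (u j x * cnj (v x))) \<partial>M)"
    by (simp add: sum_distrib_right mult.assoc)
  also have "\<dots> = (\<Sum>j\<in>X. \<integral>x. a j * (u j x * cnj (v x)) \<partial>M)"
    using assms by (intro Bochner_Integration.integral_sum integrable_mult_right
        square_integrable_mult_cnj_integrable)
  finally show ?thesis by (simp add: L2_inner_def)
qed

section \<open>Two orthogonal projections\<close>

text \<open>
  The inequality \<open>P + Q \<le> 1 + \<sigma>\<close> tested on \<open>f\<close>, with \<open>p\<close> and \<open>q\<close> in the role of \<open>Pf\<close> and \<open>Qf\<close>;
  orthogonality of the projections enters as \<open>\<langle>Pf, f\<rangle> = \<parallel>Pf\<parallel>\<^sup>2\<close> and \<open>\<langle>Qf, f\<rangle> = \<parallel>Qf\<parallel>\<^sup>2\<close>. With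
  \<open>s = \<parallel>p\<parallel>\<^sup>2 + \<parallel>q\<parallel>\<^sup>2\<close> and \<open>t = 1 + \<sigma>\<close>, expanding gives
  \<open>0 \<le> \<parallel>p + q - t f\<parallel>\<^sup>2 \<le> (1 + \<sigma>) s - 2 t s + t\<^sup>2 \<parallel>f\<parallel>\<^sup>2 = t (t \<parallel>f\<parallel>\<^sup>2 - s)\<close>.
  This choice of \<open>t\<close> replaces an application of Cauchy-Schwarz followed by a division by \<open>s\<close>.
\<close>

lemma projections_sum_bound:
  assumes f: "square_integrable M f" and p: "square_integrable M p" and q: "square_integrable M q"
    and pf: "(\<integral>x. p x \<bullet> f x \<partial>M) = (\<integral>x. p x \<bullet> p x \<partial>M)"
    and qf: "(\<integral>x. q x \<bullet> f x \<partial>M) = (\<integral>x. q x \<bullet> q x \<partial>M)"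
    and pq: "2 * (\<integral>x. p x \<bullet> q x \<partial>M) \<le> \<sigma> * ((\<integral>x. p x \<bullet> p x \<partial>M) + (\<integral>x. q x \<bullet> q x \<partial>M))"
    and "0 \<le> \<sigma>"
  shows "(\<integral>x. p x \<bullet> p x \<partial>M) + (\<integral>x. q x \<bullet> q x \<partial>M) \<le> (1 + \<sigma>) * (\<integral>x. f x \<bullet> f x \<partial>M)"
proof -
  define t where "t = 1 + \<sigma>"
  note int = square_integrable_inner_integrable
  let ?s = "(\<integral>x. p x \<bullet> p x \<partial>M) + (\<integral>x. q x \<bullet> q x \<partial>M)" and ?F = "\<integral>x. f x \<bullet> f x \<partial>M"
  have expand: "(norm (p x + q x - t *\<^sub>R f x))\<^sup>2 =
      p x \<bullet> p x + q x \<bullet> q x + 2 * (p x \<bullet> q x) - 2 * t * (p x \<bullet> f x) - 2 * t * (q x \<bullet> f x)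
        + t\<^sup>2 * (f x \<bullet> f x)" for x
    unfolding power2_norm_eq_inner
    by (simp add: inner_simps inner_commute algebra_simps power2_eq_square)
  have "0 \<le> (\<integral>x. (norm (p x + q x - t *\<^sub>R f x))\<^sup>2 \<partial>M)"
    by (rule Bochner_Integration.integral_nonneg) simp
  also have "\<dots> = ?s + 2 * (\<integral>x. p x \<bullet> q x \<partial>M) - 2 * t * ?s + t\<^sup>2 * ?F"
    unfolding expand using int[OF p p] int[OF q q] int[OF p q] int[OF p f] int[OF q f] int[OF f f]
    by (simp add: pf qf algebra_simps)
  also have "\<dots> \<le> ?s + \<sigma> * ?s - 2 * t * ?s + t\<^sup>2 * ?F" using pq by linarith
  also have "\<dots> = t * (t * ?F - ?s)" by (simp add: t_def power2_eq_square algebra_simps)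
  finally show ?thesis using \<open>0 \<le> \<sigma>\<close> by (simp add: t_def zero_le_mult_iff)
qed

text \<open>
  The number \<open>\<sigma>\<close> is an upper bound for \<open>\<parallel>QP\<parallel>\<close>, because \<open>measure M E * B\<close> bounds \<open>\<integral>\<^sub>E \<Sum>\<^sub>j |e\<^sub>j|\<^sup>2\<close>, the
  square of the Hilbert-Schmidt norm of \<open>QP\<close>. Taking \<open>\<sigma>\<close> strictly positive allows dividing by it
  in Young's inequality even when \<open>QP = 0\<close>.
\<close>

lemma concentration_sum_bound:
  fixes e :: "'i \<Rightarrow> 'a \<Rightarrow> complex"
  assumes X: "finite X" "\<And>j. j \<in> X \<Longrightarrow> square_integrable M (e j)"
    and orth: "\<And>i j. i \<in> X \<Longrightarrow> j \<in> X \<Longrightarrow> L2_inner M (e i) (e j) = (if i = j then 1 else 0)"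
    and f: "square_integrable M f"
    and E: "E \<in> sets M" "emeasure M E < \<infinity>"
    and B: "\<And>x. x \<in> E \<Longrightarrow> (\<Sum>j\<in>X. (cmod (e j x))\<^sup>2) \<le> B"
    and \<sigma>: "0 < \<sigma>" "measure M E * B \<le> \<sigma>\<^sup>2"
  shows "(\<Sum>j\<in>X. (cmod (L2_inner M f (e j)))\<^sup>2) + (LINT x:E|M. (cmod (f x))\<^sup>2)
    \<le> (1 + \<sigma>) * (L2_norm M f)\<^sup>2"
proof -
  define a where "a j = L2_inner M f (e j)" for j
  define p where "p x = (\<Sum>j\<in>X. a j * e j x)" for x
  define q where "q x = indicator E x *\<^sub>R f x" for x
  define b where "b = (\<Sum>j\<in>X. (cmod (a j))\<^sup>2)"
  have sq_p: "square_integrable M p"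
    unfolding p_def[abs_def] using X by (intro square_integrable_sum square_integrable_scale)
  have sq_q: "square_integrable M q"
    unfolding q_def[abs_def] by (rule square_integrable_restrict[OF f E(1)])
  note int = square_integrable_inner_integrable
  have "0 \<le> b" by (simp add: b_def sum_nonneg)
  have inner_p: "L2_inner M p v = (\<Sum>j\<in>X. a j * L2_inner M (e j) v)" if "square_integrable M v" for v
    unfolding p_def[abs_def] using X(2) that by (intro L2_inner_sum_left)
  have "L2_inner M p (e i) = a i" if "i \<in> X" for i
  proof -
    have "L2_inner M p (e i) = (\<Sum>j\<in>X. if j = i then a j else 0)"
      unfolding inner_p[OF X(2)[OF that]] using orth that by (intro sum.cong) auto
    then show ?thesis using X(1) that by simp
  qed
  then have "L2_inner M p p = (\<Sum>j\<in>X. a j * cnj (a j))"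
    unfolding inner_p[OF sq_p] by (intro sum.cong) (auto simp: L2_inner_commute[of M _ p])
  then have "L2_inner M p p = of_real b"
    by (simp only: b_def of_real_sum complex_norm_square)
  then have pp: "(\<integral>x. p x \<bullet> p x \<partial>M) = b"
    using Re_L2_inner[OF sq_p sq_p] by simp
  have "L2_inner M p f = (\<Sum>j\<in>X. a j * cnj (a j))"
    unfolding inner_p[OF f] by (intro sum.cong) (auto simp: a_def L2_inner_commute[of M _ f])
  then have "L2_inner M p f = of_real b"
    by (simp only: b_def of_real_sum complex_norm_square)
  then have pf: "(\<integral>x. p x \<bullet> f x \<partial>M) = b"
    using Re_L2_inner[OF sq_p f] by simp
  have qf: "(\<integral>x. q x \<bullet> f x \<partial>M) = (\<integral>x. q x \<bullet> q x \<partial>M)"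
    by (rule Bochner_Integration.integral_cong) (auto simp: q_def indicator_def)
  have p_bound: "(cmod (p x))\<^sup>2 \<le> b * B" if "x \<in> E" for x
  proof -
    have "cmod (p x) \<le> (\<Sum>j\<in>X. cmod (a j) * cmod (e j x))"
      unfolding p_def by (rule order_trans[OF norm_sum]) (simp add: norm_mult)
    then have "(cmod (p x))\<^sup>2 \<le> (\<Sum>j\<in>X. cmod (a j) * cmod (e j x))\<^sup>2"
      by (intro power_mono) auto
    also have "\<dots> \<le> b * (\<Sum>j\<in>X. (cmod (e j x))\<^sup>2)"
      unfolding b_def by (rule Cauchy_Schwarz_ineq_sum)
    also have "\<dots> \<le> b * B" using B[OF that] \<open>0 \<le> b\<close> by (rule mult_left_mono)
    finally show ?thesis .
  qed
  \<comment> \<open>Young's inequality with weight \<open>\<sigma>\<close> balances the two terms: after integration over \<open>E\<close>, the first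
    one is at most \<open>\<sigma> \<parallel>p\<parallel>\<^sup>2\<close> and the second one equals \<open>\<sigma> \<parallel>q\<parallel>\<^sup>2\<close>.\<close>
  have young: "2 * (p x \<bullet> q x) \<le> indicator E x * (b * B / \<sigma>) + \<sigma> * (q x \<bullet> q x)" for x
  proof (cases "x \<in> E")
    case True
    have "0 \<le> (norm (p x - \<sigma> *\<^sub>R q x))\<^sup>2" by simp
    also have "\<dots> = (cmod (p x))\<^sup>2 - \<sigma> * (2 * (p x \<bullet> q x)) + \<sigma> * (\<sigma> * (q x \<bullet> q x))"
      unfolding power2_norm_eq_inner by (simp add: inner_simps inner_commute algebra_simps)
    finally have "\<sigma> * (2 * (p x \<bullet> q x)) \<le> b * B + \<sigma> * (\<sigma> * (q x \<bullet> q x))"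
      using p_bound[OF True] by linarith
    then show ?thesis using True \<sigma>(1) by (simp add: field_simps)
  qed (simp add: q_def)
  have int_ind: "integrable M (\<lambda>x. indicator E x * (b * B / \<sigma>))"
    using E by (simp add: integrable_mult_left)
  have "2 * (\<integral>x. p x \<bullet> q x \<partial>M) = (\<integral>x. 2 * (p x \<bullet> q x) \<partial>M)" by simp
  also have "\<dots> \<le> (\<integral>x. indicator E x * (b * B / \<sigma>) + \<sigma> * (q x \<bullet> q x) \<partial>M)"
    using int[OF sq_p sq_q] int[OF sq_q sq_q] int_ind young by (intro integral_mono) auto
  also have "\<dots> = (\<integral>x. indicator E x * (b * B / \<sigma>) \<partial>M) + \<sigma> * (\<integral>x. q x \<bullet> q x \<partial>M)"
    using int[OF sq_q sq_q] int_ind by simp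
  also have "(\<integral>x. indicator E x * (b * B / \<sigma>) \<partial>M) = b * (measure M E * B) / \<sigma>"
    using E(1) sets.sets_into_space[OF E(1)] by (simp add: Int_absorb2)
  also have "\<dots> \<le> b * \<sigma>\<^sup>2 / \<sigma>"
    using \<sigma> \<open>0 \<le> b\<close> by (intro divide_right_mono mult_left_mono) auto
  also have "\<dots> = \<sigma> * b" using \<sigma>(1) by (simp add: power2_eq_square)
  finally have pq: "2 * (\<integral>x. p x \<bullet> q x \<partial>M) \<le> \<sigma> * (b + (\<integral>x. q x \<bullet> q x \<partial>M))"
    by (simp add: algebra_simps)
  have "b + (\<integral>x. q x \<bullet> q x \<partial>M) \<le> (1 + \<sigma>) * (\<integral>x. f x \<bullet> f x \<partial>M)"
    using projections_sum_bound[OF f sq_p sq_q _ qf] pp pf pq \<sigma>(1) by simp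
  moreover have "(\<integral>x. q x \<bullet> q x \<partial>M) = (LINT x:E|M. (cmod (f x))\<^sup>2)"
    unfolding set_lebesgue_integral_def power2_norm_eq_inner
    by (rule Bochner_Integration.integral_cong) (auto simp: q_def indicator_def)
  moreover have "(\<integral>x. f x \<bullet> f x \<partial>M) = (L2_norm M f)\<^sup>2"
    by (simp add: L2_norm_def power2_norm_eq_inner)
  ultimately show ?thesis by (simp add: b_def a_def)
qed

theorem theorem1p2:
  fixes \<A> :: "('a::t2_space, 'n::finite) chart set"
    and g :: "('a, 'n) metric"
    and vol :: "'a measure"
    and e :: "nat \<Rightarrow> 'a \<Rightarrow> complex"
    and lam :: "nat \<Rightarrow> real"
    and E :: "'a set"
    and S :: "real set"
    and f :: "'a \<Rightarrow> complex"
    and \<epsilon> \<epsilon>' :: real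
  assumes "compact_riemannian_manifold \<A> g"
    and "riemannian_volume \<A> g vol"
    and "laplace_eigenbasis \<A> g vol e lam"
    and "E \<in> sets vol"
    and "finite S" and "S \<subseteq> range lam"
    and "square_integrable vol f" and "\<not> (AE x in vol. f x = 0)"
    and "0 \<le> \<epsilon>" and "\<epsilon> < 1" and "0 \<le> \<epsilon>'" and "\<epsilon>' < 1"
    and "(LINT x:E|vol. (cmod (f x))\<^sup>2) \<ge> (1 - \<epsilon>) * (L2_norm vol f)\<^sup>2"
    and "(\<Sum>j\<in>spectral_indices lam S. (cmod (L2_inner vol f (e j)))\<^sup>2)
           \<ge> (1 - \<epsilon>') * (L2_norm vol f)\<^sup>2"
    and "0 < 1 - \<epsilon> - \<epsilon>'" and "1 - \<epsilon> - \<epsilon>' \<le> 1"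
  shows "(1 - \<epsilon> - \<epsilon>')\<^sup>2
    \<le> measure vol E / measure vol UNIV * real (card (spectral_indices lam S)) *
       (SUP x\<in>E. spectral_function e lam S x /
          (real (card (spectral_indices lam S)) / measure vol UNIV))"
proof -
  let ?X = "spectral_indices lam S"
  define N where "N = real (card ?X)"
  define m where "m = measure vol UNIV"
  define F where "F = (L2_norm vol f)\<^sup>2"
  define c where "c = 1 - \<epsilon> - \<epsilon>'"
  have space: "space vol = UNIV" and "finite_measure vol"
    using riemannian_volume_finite[OF assms(1,2)] by auto
  then interpret finite_measure vol by simp
  have f: "f \<in> borel_measurable vol" "integrable vol (\<lambda>x. (cmod (f x))\<^sup>2)"
    using assms(7) by (auto simp: square_integrable_def)
  have F_eq: "F = (\<integral>x. (cmod (f x))\<^sup>2 \<partial>vol)" by (simp add: F_def L2_norm_def)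
  have "F \<noteq> 0"
    using integral_nonneg_eq_0_iff_AE[OF f(2)] assms(8) by (simp add: F_eq)
  moreover have "0 \<le> F" by (simp add: F_def)
  ultimately have "0 < F" by simp
  \<comment> \<open>If \<open>M\<close> were a null set, \<open>f\<close> would vanish almost everywhere.\<close>
  have "m \<noteq> 0"
  proof
    assume "m = 0"
    then have "UNIV \<in> null_sets vol"
      using space by (metis emeasure_eq_measure ennreal_0 m_def null_setsI sets.top)
    then have "AE x in vol. f x = 0" by (rule AE_I') simp
    then show False using assms(8) by blast
  qed
  then have "0 < m" by (simp add: m_def less_le)
  have spectral_pos: "0 < (\<Sum>j\<in>?X. (cmod (L2_inner vol f (e j)))\<^sup>2)"
    using assms(12,14) \<open>0 < F\<close> by (smt (verit) F_def mult_pos_pos)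
  \<comment> \<open>A sum over an infinite index set is \<open>0\<close> by convention, so positivity of the sum already yields
    finiteness of \<open>X\<^sub>S\<close>.\<close>
  then have X: "finite ?X" "?X \<noteq> {}"
    using sum.infinite by fastforce+
  then have "0 < N" by (simp add: N_def card_gt_0_iff)
  have "E \<noteq> {}"
  proof
    assume "E = {}"
    then have "(LINT x:E|vol. (cmod (f x))\<^sup>2) = 0"
      by (simp add: set_lebesgue_integral_def)
    moreover have "0 < (1 - \<epsilon>) * F" using assms(10) \<open>0 < F\<close> by simp
    ultimately show False using assms(13) by (simp add: F_def)
  qed
  have basis: "L2_orthonormal_basis vol e" and smooth: "\<And>j. smooth_function \<A> (e j)"
    using assms(3) by (auto simp: laplace_eigenbasis_def)
  have "continuous_on UNIV (spectral_function e lam S)"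
    unfolding spectral_function_def[abs_def]
    using smooth_function_imp_continuous[OF _ smooth] assms(1)
    by (intro continuous_intros) (auto simp: compact_riemannian_manifold_def)
  then have "bounded (range (spectral_function e lam S))"
    using assms(1) compact_continuous_image compact_imp_bounded
    by (metis compact_riemannian_manifold_def)
  then obtain D where "\<forall>x. \<bar>spectral_function e lam S x\<bar> \<le> D"
    unfolding bounded_real by blast
  then have D: "spectral_function e lam S x \<le> D" for x
    using abs_le_D1 by blast
  define Q where "Q = (SUP x\<in>E. spectral_function e lam S x / (N / m))"
  define B where "B = Q * (N / m)"
  have bdd: "bdd_above ((\<lambda>x. spectral_function e lam S x / (N / m)) ` E)"
    using D \<open>0 < N\<close> \<open>0 < m\<close>
    by (intro bdd_aboveI2[where M = "D / (N / m)"] divide_right_mono) auto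
  have B: "spectral_function e lam S x \<le> B" if "x \<in> E" for x
  proof -
    have "spectral_function e lam S x / (N / m) \<le> Q"
      unfolding Q_def by (rule cSUP_upper[OF that bdd])
    then show ?thesis
      using \<open>0 < N\<close> \<open>0 < m\<close> by (subst (asm) pos_divide_le_eq) (auto simp: B_def)
  qed
  obtain x where "x \<in> E" using \<open>E \<noteq> {}\<close> by blast
  then have "0 \<le> B"
    using B[of x] by (smt (verit) spectral_function_def sum_nonneg zero_le_power2)
  \<comment> \<open>Approximating from above keeps \<open>sqrt K\<close> positive even if the right-hand side is \<open>0\<close>.\<close>
  have "c\<^sup>2 \<le> measure vol E * B"
  proof (rule dense_ge)
    fix K assume K: "measure vol E * B < K"
    have "0 \<le> measure vol E * B" using \<open>0 \<le> B\<close> by simp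
    then have "0 < K" using K by linarith
    have "(\<Sum>j\<in>?X. (cmod (L2_inner vol f (e j)))\<^sup>2) + (LINT x:E|vol. (cmod (f x))\<^sup>2)
        \<le> (1 + sqrt K) * (L2_norm vol f)\<^sup>2"
    proof (rule concentration_sum_bound[where B = B])
      show "emeasure vol E < \<infinity>" by (simp add: less_top[symmetric])
      show "(\<Sum>j\<in>?X. (cmod (e j x))\<^sup>2) \<le> B" if "x \<in> E" for x
        using B[OF that] by (simp add: spectral_function_def)
    qed (use X basis assms(4,7) K \<open>0 < K\<close> in \<open>auto simp: L2_orthonormal_basis_def\<close>)
    then have "(1 - \<epsilon>') * F + (1 - \<epsilon>) * F \<le> (1 + sqrt K) * F"
      using assms(13,14) by (simp add: F_def)
    then have "c * F \<le> sqrt K * F" by (simp add: c_def algebra_simps)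
    then have "c \<le> sqrt K" using \<open>0 < F\<close> by simp
    moreover have "0 \<le> c" using assms(15) by (simp add: c_def)
    ultimately have "c\<^sup>2 \<le> (sqrt K)\<^sup>2" by (intro power_mono)
    then show "c\<^sup>2 \<le> K" using \<open>0 < K\<close> by simp
  qed
  also have "measure vol E * B = measure vol E / m * N * Q" by (simp add: B_def)
  finally show ?thesis by (simp only: c_def m_def N_def Q_def)
qed

end
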